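(* Let $F:\mathbb{C}^n\to\mathbb{C}^q$ define an isolated singularity of complete intersection at infinity. Let $\{P_k\}$ be polynomials whose classes form a basis of the $\mathbb{C}$-vector space $\mathbb{C}[x_1,\dots,x_n]/(I+J)$, and let $\{\omega_l\}$ be a system of generators of the $\mathbb{C}[x_1,\dots,x_n]$-module $\ker i_X\subset\Omega^{n-q}(\mathbb{C}^n)$. Then $\{P_k\omega_l\}_{k,l}$ forms a system of generators of the $\mathbb{C}$-vector space $H^{n-q}(F^{-1}(\infty))$.
   Context: Let $1\le q<n$ be integers. $\Omega^k(\mathbb{C}^n)$ is the space of polynomial differential $k$-forms on $\mathbb{C}^n$. For an ideal $I'$ of $\mathbb{C}[x_1,\dots,x_n]$, $\omega\equiv 0\;[I']$ means $\omega\in I'\Omega^k(\mathbb{C}^n)$. $V(I')$ is the zero set of $I'$ in $\mathbb{C}^n$, and the depth of $I'$ is the codimension of $V(I')$. Fix a weighted homogeneous degree $\deg$ assigning positive integer weights $p_1,\dots,p_n>0$ to $x_1,\dots,x_n$. $\overline{P}$ denotes the leading term of a polynomial $P$, i.e. its weighted homogeneous part of highest degree. The Euler vector field is $X=\sum_i p_ix_i\,\partial/\partial x_i$, and $i_X:\Omega^{n-q}(\mathbb{C}^n)\to\Omega^{n-q-1}(\mathbb{C}^n)$, $\omega\mapsto i_X(\omega)$, is contraction along $X$, a morphism of $\mathbb{C}[x_1,\dots,x_n]$-modules. $F=(f_1,\dots,f_q):\mathbb{C}^n\to\mathbb{C}^q$ is a polynomial map, assumed dominant ($f_1,\dots,f_q$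 algebraically independent). Put $\overline{F}=(\overline{f_1},\dots,\overline{f_q})$, $I=(\overline{f_1},\dots,\overline{f_q})$, and let $J$ be the ideal generated by the $q$-minors of the Jacobian matrix $d\overline{F}$. $F$ is a complete intersection at infinity if $I$ is radical of depth $q$. The fibre at infinity is $F^{-1}(\infty)=\overline{F}^{-1}(0)$, and $\mathrm{Sing}(F^{-1}(\infty))=V(I+J)$. $F$ defines an isolated singularity of complete intersection at infinity if it is a complete intersection at infinity and $\dim\mathrm{Sing}(F^{-1}(\infty))=0$. A polynomial $k$-form $\omega$ is closed at infinity if $d\omega\wedge d\overline{f_1}\wedge\dots\wedge d\overline{f_q}\equiv 0\;[I]$, and exact at infinity if $\omega\in d\Omega^{k-1}(\mathbb{C}^n)+I\,\Omega^k(\mathbb{C}^n)$. $H^k(F^{-1}(\infty))$ is the quotient of closed $k$-forms at infinity by exact $k$-forms at infinity. *)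

theory Defs
  imports
    "HOL-Library.Poly_Mapping"
    "HOL-Library.Function_Algebras"
    "HOL-Library.Set_Algebras"
    "HOL-Library.Cardinality"
    "HOL-Library.Extended_Real"
    "Jordan_Normal_Form.Determinant"
begin

section \<open>Quotients of vector spaces\<close>

text \<open>
  The elements of \<open>V / W\<close> are the cosets \<open>v +o W\<close> with \<open>v\<close> in \<open>V\<close>.  Its operations are those of
  representatives, so a linear combination of classes is the class of the same linear combination of
  representatives.
\<close>

definition quotient_space :: "'b::ab_group_add set \<Rightarrow> 'b set \<Rightarrow> 'b set set" where
  "quotient_space V W = (\<lambda>v. v +o W) ` V"

definition generates_quotient ::
    "('a::field \<Rightarrow> 'b::ab_group_add \<Rightarrow> 'b) \<Rightarrow> 'b set \<Rightarrow> 'b set \<Rightarrow> 'b set \<Rightarrow> bool" where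
  "generates_quotient scale V W S \<longleftrightarrow>
     S \<subseteq> V \<and> (\<lambda>u. u +o W) ` Modules.module.span scale S = quotient_space V W"

definition independent_in_quotient ::
    "('a::field \<Rightarrow> 'b::ab_group_add \<Rightarrow> 'b) \<Rightarrow> 'b set \<Rightarrow> ('k \<Rightarrow> 'b) \<Rightarrow> 'k set \<Rightarrow> bool" where
  "independent_in_quotient scale W v K \<longleftrightarrow>
     (\<forall>A c. finite A \<longrightarrow> A \<subseteq> K \<longrightarrow> (\<Sum>k\<in>A. scale (c k) (v k)) +o W = 0 +o W \<longrightarrow> (\<forall>k\<in>A. c k = 0))"

definition basis_of_quotient ::
    "('a::field \<Rightarrow> 'b::ab_group_add \<Rightarrow> 'b) \<Rightarrow> 'b set \<Rightarrow> 'b set \<Rightarrow> ('k \<Rightarrow> 'b) \<Rightarrow> 'k set \<Rightarrow> bool" where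
  "basis_of_quotient scale V W v K \<longleftrightarrow>
     generates_quotient scale V W (v ` K) \<and> independent_in_quotient scale W v K"


section \<open>Polynomials\<close>

text \<open>The variables are indexed by \<open>'n\<close>, a monomial by its exponents.\<close>

type_synonym 'n mpoly = "('n \<Rightarrow>\<^sub>0 nat) \<Rightarrow>\<^sub>0 complex"

definition const_poly :: "complex \<Rightarrow> 'n mpoly" where
  "const_poly c = Poly_Mapping.single 0 c"

lemma const_poly_add: "const_poly (a + b) = const_poly a + const_poly b"
  by (simp add: const_poly_def single_add)

lemma const_poly_mult: "const_poly (a * b) = const_poly a * const_poly b"
  by (simp add: const_poly_def mult_single)

lemma const_poly_1: "const_poly 1 = 1"
  by (simp add: const_poly_def)

definition var_poly :: "'n \<Rightarrow> 'n mpoly" where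
  "var_poly i = Poly_Mapping.single (Poly_Mapping.single i 1) 1"

text \<open>
  Evaluation at a tuple in a commutative \<open>\<complex>\<close>-algebra with structure map \<open>\<phi>\<close>: this covers both the value
  at a point and the substitution of polynomials for the variables.
\<close>

definition poly_eval :: "(complex \<Rightarrow> 'r::comm_ring_1) \<Rightarrow> ('v \<Rightarrow> 'r) \<Rightarrow> 'v mpoly \<Rightarrow> 'r" where
  "poly_eval \<phi> a P = (\<Sum>m\<in>Poly_Mapping.keys P.
     \<phi> (Poly_Mapping.lookup P m) *
       (\<Prod>i\<in>Poly_Mapping.keys m. a i ^ Poly_Mapping.lookup m i))"

definition pdiff :: "'n \<Rightarrow> 'n mpoly \<Rightarrow> 'n mpoly" where
  "pdiff i P = (\<Sum>m\<in>Poly_Mapping.keys P.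
     Poly_Mapping.single (m - Poly_Mapping.single i 1)
       (of_nat (Poly_Mapping.lookup m i) * Poly_Mapping.lookup P m))"

text \<open>
  Ideals are the submodules for the scalar multiplication \<open>(*)\<close>.  That module is not interpreted,
  because its \<open>simp\<close> rules would loop with \<open>mult.assoc\<close>.
\<close>

lemma module_mpoly: "Modules.module ((*) :: 'n mpoly \<Rightarrow> 'n mpoly \<Rightarrow> 'n mpoly)"
  by unfold_locales (simp_all add: algebra_simps)

abbreviation ideal_span :: "'n mpoly set \<Rightarrow> 'n mpoly set" where
  "ideal_span \<equiv> Modules.module.span (*)"

definition poly_cscale :: "complex \<Rightarrow> 'n mpoly \<Rightarrow> 'n mpoly" where
  "poly_cscale c P = const_poly c * P"

global_interpretation poly_vs: vector_space "poly_cscale :: complex \<Rightarrow> 'n mpoly \<Rightarrow> 'n mpoly"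
  by unfold_locales
    (simp_all add: poly_cscale_def const_poly_add const_poly_mult const_poly_1 algebra_simps)

text \<open>A polynomial in \<open>q\<close> variables is a \<open>nat mpoly\<close> involving only variables of index less than \<open>q\<close>.\<close>

definition algebraically_independent :: "nat \<Rightarrow> (nat \<Rightarrow> 'n mpoly) \<Rightarrow> bool" where
  "algebraically_independent q f \<longleftrightarrow>
     (\<forall>P :: nat mpoly. (\<forall>m\<in>Poly_Mapping.keys P. Poly_Mapping.keys m \<subseteq> {..<q}) \<longrightarrow>
        poly_eval const_poly f P = 0 \<longrightarrow> P = 0)"

definition radical_ideal :: "'n mpoly set \<Rightarrow> bool" where
  "radical_ideal I \<longleftrightarrow> (\<forall>g m. g ^ m \<in> I \<longrightarrow> g \<in> I)"

definition weighted_degree :: "('n::finite \<Rightarrow> nat) \<Rightarrow> ('n \<Rightarrow>\<^sub>0 nat) \<Rightarrow> nat" where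
  "weighted_degree p m = (\<Sum>i\<in>UNIV. p i * Poly_Mapping.lookup m i)"

definition leading_term :: "('n::finite \<Rightarrow> nat) \<Rightarrow> 'n mpoly \<Rightarrow> 'n mpoly" where
  "leading_term p P =
     (\<Sum>m | m \<in> Poly_Mapping.keys P \<and>
           (\<forall>m'\<in>Poly_Mapping.keys P. weighted_degree p m' \<le> weighted_degree p m).
        Poly_Mapping.single m (Poly_Mapping.lookup P m))"


section \<open>Algebraic sets and dimension\<close>

definition zero_set :: "'n mpoly set \<Rightarrow> ('n \<Rightarrow> complex) set" where
  "zero_set S = {a. \<forall>P\<in>S. poly_eval (\<lambda>c. c) a P = 0}"

definition zariski_closed :: "('n \<Rightarrow> complex) set \<Rightarrow> bool" where
  "zariski_closed Z \<longleftrightarrow> (\<exists>S. Z = zero_set S)"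

definition irreducible_closed :: "('n \<Rightarrow> complex) set \<Rightarrow> bool" where
  "irreducible_closed Z \<longleftrightarrow> zariski_closed Z \<and> Z \<noteq> {} \<and>
     (\<forall>A B. zariski_closed A \<longrightarrow> zariski_closed B \<longrightarrow> Z = A \<union> B \<longrightarrow> Z = A \<or> Z = B)"

text \<open>
  The Krull dimension, for Zariski closed \<open>V\<close>.  As the supremum is taken in the extended reals, the
  empty set has dimension \<open>-\<infinity>\<close>, hence codimension \<open>\<infinity>\<close>.
\<close>

definition zariski_dim :: "('n \<Rightarrow> complex) set \<Rightarrow> ereal" where
  "zariski_dim V = Sup {ereal (real m) | m. \<exists>Z.
     (\<forall>i\<le>m. irreducible_closed (Z i) \<and> Z i \<subseteq> V) \<and> (\<forall>i<m. Z i \<subset> Z (Suc i))}"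

definition depth :: "'n::finite mpoly set \<Rightarrow> ereal" where
  "depth I = ereal (real CARD('n)) - zariski_dim (zero_set I)"


section \<open>Polynomial differential forms\<close>

text \<open>
  A form is given by its coefficients: \<open>\<omega> {i\<^sub>1, \<dots>, i\<^sub>k}\<close> with \<open>i\<^sub>1 < \<dots> < i\<^sub>k\<close> is the coefficient of
  \<open>dx\<^sub>i\<^sub>1 \<and> \<dots> \<and> dx\<^sub>i\<^sub>k\<close>.
\<close>

type_synonym 'n form = "'n set \<Rightarrow> 'n mpoly"

definition forms :: "nat \<Rightarrow> 'n form set" where
  "forms k = {\<omega>. \<forall>K. card K \<noteq> k \<longrightarrow> \<omega> K = 0}"

definition form_scale :: "'n mpoly \<Rightarrow> 'n form \<Rightarrow> 'n form" where
  "form_scale P \<omega> = (\<lambda>K. P * \<omega> K)"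

global_interpretation form_module: Modules.module "form_scale :: 'n mpoly \<Rightarrow> 'n form \<Rightarrow> 'n form"
  by unfold_locales (simp_all add: form_scale_def fun_eq_iff algebra_simps)

definition form_cscale :: "complex \<Rightarrow> 'n form \<Rightarrow> 'n form" where
  "form_cscale c \<omega> = form_scale (const_poly c) \<omega>"

global_interpretation form_vs: vector_space "form_cscale :: complex \<Rightarrow> 'n form \<Rightarrow> 'n form"
  by unfold_locales
    (simp_all add: form_cscale_def form_scale_def const_poly_add const_poly_mult const_poly_1
      fun_eq_iff algebra_simps)

definition function_form :: "'n mpoly \<Rightarrow> 'n form" where
  "function_form g = (\<lambda>K. if K = {} then g else 0)"

text \<open>The sign with \<open>dx\<^sub>A \<and> dx\<^sub>B = shuffle_sign A B \<cdot> dx\<^bsub>A \<union> B\<^esub>\<close> for disjoint \<open>A\<close> and \<open>B\<close>.\<close>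

definition shuffle_sign :: "'n::linorder set \<Rightarrow> 'n set \<Rightarrow> 'n mpoly" where
  "shuffle_sign A B = (-1) ^ card {(a, b). a \<in> A \<and> b \<in> B \<and> b < a}"

definition wedge :: "'n::{finite,linorder} form \<Rightarrow> 'n form \<Rightarrow> 'n form" where
  "wedge \<alpha> \<beta> = (\<lambda>K. \<Sum>A\<in>Pow K. shuffle_sign A (K - A) * \<alpha> A * \<beta> (K - A))"

definition ext_deriv :: "'n::{finite,linorder} form \<Rightarrow> 'n form" where
  "ext_deriv \<omega> = (\<lambda>K. \<Sum>i\<in>K. shuffle_sign {i} (K - {i}) * pdiff i (\<omega> (K - {i})))"

text \<open>Contraction along the vector field \<open>\<Sum>\<^sub>i X\<^sub>i \<partial>/\<partial>x\<^sub>i\<close>.\<close>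

definition contraction :: "('n::{finite,linorder} \<Rightarrow> 'n mpoly) \<Rightarrow> 'n form \<Rightarrow> 'n form" where
  "contraction X \<omega> = (\<lambda>K. \<Sum>i\<in>- K. shuffle_sign {i} K * X i * \<omega> (insert i K))"

definition euler_field :: "('n \<Rightarrow> nat) \<Rightarrow> 'n \<Rightarrow> 'n mpoly" where
  "euler_field p i = of_nat (p i) * var_poly i"

definition ideal_forms :: "'n mpoly set \<Rightarrow> nat \<Rightarrow> 'n form set" where
  "ideal_forms I k = form_module.span {form_scale P \<omega> | P \<omega>. P \<in> I \<and> \<omega> \<in> forms k}"


section \<open>Behaviour at infinity\<close>

text \<open>The map \<open>F = (f\<^sub>1, \<dots>, f\<^sub>q)\<close> is given by \<open>f 0, \<dots>, f (q - 1)\<close>; other values of \<open>f\<close> are irrelevant.\<close>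

definition ideal_at_infinity :: "('n::finite \<Rightarrow> nat) \<Rightarrow> nat \<Rightarrow> (nat \<Rightarrow> 'n mpoly) \<Rightarrow> 'n mpoly set" where
  "ideal_at_infinity p q f = ideal_span ((\<lambda>i. leading_term p (f i)) ` {..<q})"

definition jacobian_minor ::
    "('n::{finite,linorder} \<Rightarrow> nat) \<Rightarrow> nat \<Rightarrow> (nat \<Rightarrow> 'n mpoly) \<Rightarrow> 'n set \<Rightarrow> 'n mpoly" where
  "jacobian_minor p q f K =
     det (mat q q (\<lambda>(i, j). pdiff (sorted_list_of_set K ! j) (leading_term p (f i))))"

definition jacobian_ideal ::
    "('n::{finite,linorder} \<Rightarrow> nat) \<Rightarrow> nat \<Rightarrow> (nat \<Rightarrow> 'n mpoly) \<Rightarrow> 'n mpoly set" where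
  "jacobian_ideal p q f = ideal_span {jacobian_minor p q f K | K. card K = q}"

definition complete_intersection_at_infinity ::
    "('n::finite \<Rightarrow> nat) \<Rightarrow> nat \<Rightarrow> (nat \<Rightarrow> 'n mpoly) \<Rightarrow> bool" where
  "complete_intersection_at_infinity p q f \<longleftrightarrow>
     radical_ideal (ideal_at_infinity p q f) \<and> depth (ideal_at_infinity p q f) = ereal (real q)"

definition singular_fibre_at_infinity ::
    "('n::{finite,linorder} \<Rightarrow> nat) \<Rightarrow> nat \<Rightarrow> (nat \<Rightarrow> 'n mpoly) \<Rightarrow> ('n \<Rightarrow> complex) set" where
  "singular_fibre_at_infinity p q f =
     zero_set (ideal_at_infinity p q f + jacobian_ideal p q f)"

definition isolated_complete_intersection_at_infinity ::
    "('n::{finite,linorder} \<Rightarrow> nat) \<Rightarrow> nat \<Rightarrow> (nat \<Rightarrow> 'n mpoly) \<Rightarrow> bool" where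
  "isolated_complete_intersection_at_infinity p q f \<longleftrightarrow>
     complete_intersection_at_infinity p q f \<and> zariski_dim (singular_fibre_at_infinity p q f) = 0"

definition closed_at_infinity ::
    "('n::{finite,linorder} \<Rightarrow> nat) \<Rightarrow> nat \<Rightarrow> (nat \<Rightarrow> 'n mpoly) \<Rightarrow> nat \<Rightarrow> 'n form set" where
  "closed_at_infinity p q f k = {\<omega> \<in> forms k.
     foldl wedge (ext_deriv \<omega>)
       (map (\<lambda>i. ext_deriv (function_form (leading_term p (f i)))) [0..<q])
     \<in> ideal_forms (ideal_at_infinity p q f) (k + 1 + q)}"

text \<open>There are no nonzero forms of degree \<open>-1\<close>.\<close>

definition exact_at_infinity ::
    "('n::{finite,linorder} \<Rightarrow> nat) \<Rightarrow> nat \<Rightarrow> (nat \<Rightarrow> 'n mpoly) \<Rightarrow> nat \<Rightarrow> 'n form set" where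
  "exact_at_infinity p q f k =
     ext_deriv ` (if k = 0 then {0} else forms (k - 1)) + ideal_forms (ideal_at_infinity p q f) k"

end

(*
  Let i be contraction along the Euler field X.  Since the Lie derivative of X = d i + i d multiplies a
  weighted homogeneous form of positive degree by its weight, which is positive, every form theta is
  d(alpha) + i(eta), and theta = i(eta) if i(theta) = 0.  Hence forms of degree n - q are combinations
  of the omega_l with polynomial coefficients, modulo exact forms, and coefficients only matter modulo
  I and modulo multipliers of ker i into the exact forms.  Each minor m is such a multiplier: if
  theta = i(eta), then eta has degree n - q + 1, so df_1 ... df_q eta = 0 (leading terms throughout);
  contracting this with the coordinate fields of the minor gives m eta = sum df_i theta_i, whence
  m theta = sum (X f_i) theta_i - df_i i(theta_i), where X f_i is a multiple of f_i and
  df_i i(theta_i) = d(f_i i(theta_i)) - f_i d i(theta_i).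
*)

theory Submission
  imports Defs
begin

section \<open>Polynomials\<close>

text \<open>A polynomial is the finite sum of its terms, so identities between additive operators
  need checking on monomials only. The zero polynomial is a term with coefficient 0.\<close>

lemma mpoly_induct [case_names single add]:
  fixes P :: "'n mpoly"
  assumes single: "\<And>m a. Q (Poly_Mapping.single m a)"
    and add: "\<And>P R. Q P \<Longrightarrow> Q R \<Longrightarrow> Q (P + R)"
  shows "Q P"
proof -
  have "Q (\<Sum>m\<in>A. Poly_Mapping.single m (Poly_Mapping.lookup P m))" if "finite A" for A
    using that
  proof induction
    case empty
    show ?case using single[of 0 0] by simp
  qed (simp add: single add)
  moreover have "P = (\<Sum>m\<in>Poly_Mapping.keys P. Poly_Mapping.single m (Poly_Mapping.lookup P m))"
    by (rule poly_mapping_eqI)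
      (simp add: lookup_sum lookup_single when_def sum.delta' in_keys_iff)
  ultimately show ?thesis by (metis finite_keys)
qed

text \<open>Common shape of \<open>pdiff\<close> and \<open>degree_quotient\<close>, which both send
  a monomial to a multiple of a single monomial; additivity is proved once for both.\<close>

definition monomial_map ::
    "(('n \<Rightarrow>\<^sub>0 nat) \<Rightarrow> ('n \<Rightarrow>\<^sub>0 nat)) \<Rightarrow> (('n \<Rightarrow>\<^sub>0 nat) \<Rightarrow> complex) \<Rightarrow> 'n mpoly \<Rightarrow> 'n mpoly" where
  "monomial_map h c P =
     (\<Sum>m\<in>Poly_Mapping.keys P. Poly_Mapping.single (h m) (c m * Poly_Mapping.lookup P m))"

lemma monomial_map_add: "monomial_map h c (P + Q) = monomial_map h c P + monomial_map h c Q"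
  unfolding monomial_map_def
  by (rule setsum_keys_plus_distrib) (simp_all add: single_add distrib_left)

lemma monomial_map_single [simp]:
  "monomial_map h c (Poly_Mapping.single m a) = Poly_Mapping.single (h m) (c m * a)"
  by (simp add: monomial_map_def)

lemma pdiff_monomial_map:
  "pdiff i = monomial_map (\<lambda>m. m - Poly_Mapping.single i 1) (\<lambda>m. of_nat (Poly_Mapping.lookup m i))"
  by (simp add: fun_eq_iff pdiff_def monomial_map_def)

lemma pdiff_single [simp]:
  "pdiff i (Poly_Mapping.single m a) =
     Poly_Mapping.single (m - Poly_Mapping.single i 1) (of_nat (Poly_Mapping.lookup m i) * a)"
  by (simp add: pdiff_monomial_map)

lemma pdiff_add: "pdiff i (P + Q) = pdiff i P + pdiff i Q"
  by (simp add: pdiff_monomial_map monomial_map_add)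

lemma additive_pdiff: "Modules.additive (pdiff i)"
  by standard (rule pdiff_add)

lemma pdiff_mult_single:
  "pdiff i (Poly_Mapping.single m a * Poly_Mapping.single m' b) =
     pdiff i (Poly_Mapping.single m a) * Poly_Mapping.single m' b +
     Poly_Mapping.single m a * pdiff i (Poly_Mapping.single m' b)"
proof -
  let ?e = "Poly_Mapping.single i (1::nat)"
  \<comment> \<open>Exponents are subtracted with truncation, so the shift is valid only if
    \<open>i\<close> occurs in \<open>k\<close>; otherwise the coefficient is 0 and both terms
    vanish.\<close>
  have shift: "k - ?e + l = k + l - ?e" if "Poly_Mapping.lookup k i \<noteq> 0" for k l :: "'a \<Rightarrow>\<^sub>0 nat"
    using that by (intro poly_mapping_eqI) (auto simp: lookup_add lookup_minus lookup_single when_def)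
  have "Poly_Mapping.single (k - ?e + l) (of_nat (Poly_Mapping.lookup k i) * c) =
      Poly_Mapping.single (k + l - ?e) (of_nat (Poly_Mapping.lookup k i) * c)"
    for k l :: "'a \<Rightarrow>\<^sub>0 nat" and c :: complex
    using shift[of k l] by (cases "Poly_Mapping.lookup k i = 0") auto
  from this[of m m' "a * b"] this[of m' m "a * b"] show ?thesis
    by (simp add: mult_single lookup_add distrib_right distrib_left single_add ac_simps)
qed

lemma pdiff_mult: "pdiff i (P * Q) = pdiff i P * Q + P * pdiff i Q"
proof (induction P rule: mpoly_induct)
  case (single m a)
  show ?case
  proof (induction Q rule: mpoly_induct)
    case (single m' b)
    show ?case by (rule pdiff_mult_single)
  next
    case (add P R)
    then show ?case by (simp add: distrib_left pdiff_add)
  qed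
next
  case (add P R)
  then show ?case by (simp add: distrib_right pdiff_add)
qed

lemma pdiff_var: "pdiff i (var_poly j) = (if i = j then 1 else 0)"
  by (auto simp: var_poly_def lookup_single when_def)

lemma pdiff_of_nat [simp]: "pdiff i (of_nat c) = 0"
proof -
  have "pdiff i 1 = 0"
    by (metis pdiff_single single_one lookup_zero mult_eq_0_iff of_nat_0 single_zero)
  then show ?thesis
    using additive.zero[OF additive_pdiff[of i]] by (induction c) (simp_all add: pdiff_add)
qed

lemma pdiff_euler_field: "pdiff i (euler_field p j) = (if i = j then of_nat (p i) else 0)"
  by (simp add: euler_field_def pdiff_mult pdiff_var)

lemma of_nat_mult_single:
  "of_nat k * Poly_Mapping.single m a = (Poly_Mapping.single m (of_nat k * a) :: 'n mpoly)"
  using mult_single[of 0 "of_nat k" m a] by simp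

section \<open>The Euler derivation and weighted degrees\<close>

definition euler_deriv :: "('n::finite \<Rightarrow> nat) \<Rightarrow> 'n mpoly \<Rightarrow> 'n mpoly" where
  "euler_deriv p P = (\<Sum>i\<in>UNIV. euler_field p i * pdiff i P)"

lemma euler_deriv_add: "euler_deriv p (P + Q) = euler_deriv p P + euler_deriv p Q"
  by (simp add: euler_deriv_def pdiff_add distrib_left sum.distrib)

text \<open>Each operator x_i d/dx_i multiplies a monomial by its exponent at i; the weighted sum of
  these exponents is the eigenvalue.\<close>

lemma euler_deriv_single:
  "euler_deriv p (Poly_Mapping.single m a) =
     Poly_Mapping.single m (of_nat (weighted_degree p m) * a)"
proof -
  have "euler_field p i * pdiff i (Poly_Mapping.single m a) =
      Poly_Mapping.single m (of_nat (p i * Poly_Mapping.lookup m i) * a)" for i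
  proof (cases "Poly_Mapping.lookup m i = 0")
    case False
    then have "Poly_Mapping.single i 1 + (m - Poly_Mapping.single i 1) = m"
      by (intro poly_mapping_eqI) (auto simp: lookup_add lookup_minus lookup_single when_def)
    then show ?thesis
      by (simp add: euler_field_def var_poly_def of_nat_mult_single mult_single mult.assoc)
  qed simp
  moreover have "(\<Sum>i\<in>A. Poly_Mapping.single m (g i)) = Poly_Mapping.single m (\<Sum>i\<in>A. g i)"
    for A and g :: "_ \<Rightarrow> complex"
    by (induction A rule: infinite_finite_induct) (simp_all add: single_add)
  ultimately show ?thesis
    by (simp add: euler_deriv_def weighted_degree_def sum_distrib_right)
qed

text \<open>All monomials of a leading term share one weighted degree, so Euler's identity applies.
  Later this puts X(f) into the ideal generated by the leading terms f.\<close>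

lemma euler_deriv_leading_term:
  "\<exists>d. euler_deriv p (leading_term p P) = of_nat d * leading_term p P"
proof -
  define T where "T = {m \<in> Poly_Mapping.keys P.
    \<forall>m'\<in>Poly_Mapping.keys P. weighted_degree p m' \<le> weighted_degree p m}"
  \<comment> \<open>Two monomials of \<open>T\<close> bound each other's degree; if \<open>T\<close>
    is empty, any \<open>d\<close> will do.\<close>
  obtain d where d: "\<And>m. m \<in> T \<Longrightarrow> weighted_degree p m = d"
    unfolding T_def by (metis (no_types, lifting) mem_Collect_eq order_antisym)
  have zero: "euler_deriv p 0 = 0"
    using euler_deriv_add[of p 0 0] by simp
  have "euler_deriv p (\<Sum>m\<in>A. Poly_Mapping.single m (g m)) =
      of_nat d * (\<Sum>m\<in>A. Poly_Mapping.single m (g m))" if "A \<subseteq> T" for A g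
    using that
  proof (induction A rule: infinite_finite_induct)
    case (insert m A)
    then show ?case
      by (simp add: euler_deriv_add euler_deriv_single of_nat_mult_single d distrib_left)
  qed (simp_all add: zero)
  then show ?thesis unfolding leading_term_def T_def by blast
qed

text \<open>For \<open>r = 0\<close> the division by zero makes this vanish on constants.\<close>

definition degree_quotient :: "('n::finite \<Rightarrow> nat) \<Rightarrow> nat \<Rightarrow> 'n mpoly \<Rightarrow> 'n mpoly" where
  "degree_quotient p r = monomial_map id (\<lambda>m. 1 / of_nat (weighted_degree p m + r))"

lemma degree_quotient_add:
  "degree_quotient p r (P + Q) = degree_quotient p r P + degree_quotient p r Q"
  by (simp add: degree_quotient_def monomial_map_add)

text \<open>The operator X + r is diagonal on monomials with eigenvalues
  \<open>weighted_degree p m + r\<close>, nonzero because \<open>r > 0\<close>, so dividing by them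
  inverts it.\<close>

lemma euler_deriv_degree_quotient:
  assumes "r > 0"
  shows "euler_deriv p (degree_quotient p r P) + of_nat r * degree_quotient p r P = P"
proof (induction P rule: mpoly_induct)
  case (single m a)
  have "(of_nat (weighted_degree p m + r) :: complex) \<noteq> 0"
    using assms unfolding of_nat_eq_0_iff by simp
  then show ?case
    by (simp add: degree_quotient_def euler_deriv_single of_nat_mult_single
        flip: single_add add_divide_distrib distrib_right)
next
  case (add P R)
  then show ?case
    by (simp add: degree_quotient_add euler_deriv_add distrib_left algebra_simps)
qed

lemma weighted_degree_add: "weighted_degree p (m + m') = weighted_degree p m + weighted_degree p m'"
  by (simp add: weighted_degree_def lookup_add distrib_left sum.distrib)

lemma weighted_degree_single: "weighted_degree p (Poly_Mapping.single i k) = p i * k"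
  by (simp add: weighted_degree_def lookup_single when_def if_distrib cong: if_cong)

text \<open>A factor x_i raises the weighted degree by \<open>p i\<close>. This is the weight that
  dx_i carries, which will make the homotopy commute with contraction.\<close>

lemma degree_quotient_euler_field:
  "degree_quotient p r (euler_field p i * P) = euler_field p i * degree_quotient p (r + p i) P"
proof (induction P rule: mpoly_induct)
  case (single m a)
  show ?case
    by (simp add: euler_field_def var_poly_def degree_quotient_def mult_single of_nat_mult_single
        weighted_degree_add weighted_degree_single ac_simps)
next
  case (add P R)
  then show ?case by (simp add: degree_quotient_add distrib_left)
qed

section \<open>Forms\<close>

lemma shuffle_sign_singleton: "shuffle_sign {i} K = (-1) ^ card {b \<in> K. b < i}"
proof -
  have "{(a, b). a \<in> {i} \<and> b \<in> K \<and> b < a} = Pair i ` {b \<in> K. b < i}"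
    by auto
  then show ?thesis
    by (simp add: shuffle_sign_def card_image inj_on_def)
qed

lemma shuffle_sign_insert:
  fixes K :: "'n::{finite,linorder} set"
  assumes "j \<notin> K"
  shows "shuffle_sign {i} (insert j K) = (if j < i then -1 else 1) * shuffle_sign {i} K"
proof -
  have "{b \<in> insert j K. b < i} = (if j < i then insert j {b \<in> K. b < i} else {b \<in> K. b < i})"
    by auto
  then show ?thesis
    using assms by (simp add: shuffle_sign_singleton)
qed

lemma shuffle_sign_cases: "shuffle_sign {i} K = 1 \<or> shuffle_sign {i} K = -1"
  unfolding shuffle_sign_singleton by (metis neg_one_even_power neg_one_odd_power)

lemma shuffle_sign_cancel: "shuffle_sign {i} K * (shuffle_sign {i} K * P) = P"
  using shuffle_sign_cases[of i K] by auto

text \<open>The sign is 1 or -1, so additive maps pass through it, derivations included.\<close>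

lemma additive_shuffle_sign:
  assumes "Modules.additive D"
  shows "D (shuffle_sign {i} K * P) = shuffle_sign {i} K * D P"
  using shuffle_sign_cases[of i K] additive.minus[OF assms] by auto

text \<open>Exactly one of \<open>i < j\<close> and \<open>j < i\<close> holds, so exactly one of
  the two insertions flips a sign: this is the anticommutation of dx_i and dx_j.\<close>

lemma shuffle_sign_exchange:
  fixes K :: "'n::{finite,linorder} set"
  assumes "i \<notin> K" "j \<notin> K" "i \<noteq> j"
  shows "shuffle_sign {j} (insert i K) * shuffle_sign {i} K =
    - (shuffle_sign {i} (insert j K) * shuffle_sign {j} K)"
  using assms by (auto simp: shuffle_sign_insert not_less_iff_gr_or_eq)

lemma shuffle_sign_insert_both:
  fixes K :: "'n::{finite,linorder} set"
  assumes "i \<notin> K" "j \<notin> K" "i \<noteq> j"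
  shows "shuffle_sign {j} (insert i K) * shuffle_sign {i} (insert j K) =
    - (shuffle_sign {i} K * shuffle_sign {j} K)"
  using assms by (auto simp: shuffle_sign_insert not_less_iff_gr_or_eq)

text \<open>Covers the exterior derivative (\<open>D = pdiff\<close>) and the exterior product with a 1-form.\<close>

definition wedge_op ::
    "('n::{finite,linorder} \<Rightarrow> 'n mpoly \<Rightarrow> 'n mpoly) \<Rightarrow> 'n form \<Rightarrow> 'n form" where
  "wedge_op D \<theta> = (\<lambda>K. \<Sum>i\<in>K. shuffle_sign {i} (K - {i}) * D i (\<theta> (K - {i})))"

lemma ext_deriv_wedge_op: "ext_deriv = wedge_op pdiff"
  by (simp add: fun_eq_iff ext_deriv_def wedge_op_def)

text \<open>In the two composites the terms that remove \<open>i\<close> and insert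
  \<open>j \<noteq> i\<close> cancel, so only the diagonal terms remain. This yields both Cartan's
  formula and the antiderivation rule for contraction. The condition \<open>i \<noteq> j\<close> in
  \<open>commute\<close> is there because \<open>pdiff i\<close> does not commute with
  multiplication by x_i.\<close>

lemma wedge_op_contraction:
  assumes additive: "\<And>i. Modules.additive (D i)"
    and commute: "\<And>i j P. i \<noteq> j \<Longrightarrow> D i (X j * P) = X j * D i P"
  shows "wedge_op D (contraction X \<theta>) K + contraction X (wedge_op D \<theta>) K =
    (\<Sum>i\<in>K. D i (X i * \<theta> K)) + (\<Sum>i\<in>- K. X i * D i (\<theta> K))"
proof -
  let ?s = "\<lambda>i. shuffle_sign {i}"
  \<comment> \<open>The cross term that removes \<open>i \<in> K\<close> and inserts
    \<open>j \<notin> K\<close>.\<close>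
  define T where "T i j = ?s i (K - {i}) * ?s j (K - {i}) * (X j * D i (\<theta> (insert j (K - {i}))))"
    for i j
  have "wedge_op D (contraction X \<theta>) K = (\<Sum>i\<in>K. D i (X i * \<theta> K) + (\<Sum>j\<in>- K. T i j))"
    unfolding wedge_op_def
  proof (rule sum.cong[OF refl])
    fix i assume i: "i \<in> K"
    have "D i (contraction X \<theta> (K - {i})) =
        (\<Sum>j\<in>- (K - {i}). ?s j (K - {i}) * D i (X j * \<theta> (insert j (K - {i}))))"
      by (simp add: contraction_def additive.sum[OF additive] additive_shuffle_sign[OF additive]
          mult.assoc)
    \<comment> \<open>Once removed, \<open>i\<close> is itself an index that contraction can put
      back; it gives the diagonal term.\<close>
    also have "- (K - {i}) = insert i (- K)"
      using i by auto
    also have "(\<Sum>j\<in>insert i (- K). ?s j (K - {i}) * D i (X j * \<theta> (insert j (K - {i})))) =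
        ?s i (K - {i}) * D i (X i * \<theta> K) +
        (\<Sum>j\<in>- K. ?s j (K - {i}) * (X j * D i (\<theta> (insert j (K - {i})))))"
      using i by (subst sum.insert) (auto simp: insert_absorb intro!: sum.cong commute)
    finally show "?s i (K - {i}) * D i (contraction X \<theta> (K - {i})) =
        D i (X i * \<theta> K) + (\<Sum>j\<in>- K. T i j)"
      by (simp only: distrib_left T_def sum_distrib_left mult.assoc shuffle_sign_cancel)
  qed
  moreover have "contraction X (wedge_op D \<theta>) K =
      (\<Sum>j\<in>- K. X j * D j (\<theta> K) - (\<Sum>i\<in>K. T i j))"
    unfolding contraction_def
  proof (rule sum.cong[OF refl])
    fix j assume j: "j \<in> - K"
    \<comment> \<open>The same cross term in the opposite order; its sign is reversed by
      \<open>shuffle_sign_insert_both\<close> for the set \<open>K - {i}\<close>.\<close>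
    have "?s j K * (?s i (insert j K - {i}) * (X j * D i (\<theta> (insert j K - {i})))) = - T i j"
      if i: "i \<in> K" for i
    proof -
      have *: "insert j K - {i} = insert j (K - {i})" and "insert i (K - {i}) = K"
        using i j by auto
      with shuffle_sign_insert_both[of i "K - {i}" j] i j
      have "?s j K * ?s i (insert j (K - {i})) = - (?s i (K - {i}) * ?s j (K - {i}))"
        by (metis ComplD DiffD1 Diff_iff insertCI)
      then show ?thesis
        unfolding T_def * mult.assoc[symmetric] by (simp only: mult_minus_left)
    qed
    then have "?s j K * X j * (\<Sum>i\<in>K. ?s i (insert j K - {i}) * D i (\<theta> (insert j K - {i}))) =
        - (\<Sum>i\<in>K. T i j)"
      unfolding sum_distrib_left sum_negf[symmetric] by (intro sum.cong) (simp_all add: ac_simps)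
    moreover have "insert j K - {j} = K"
      using j by auto
    ultimately show "?s j K * X j * wedge_op D \<theta> (insert j K) =
        X j * D j (\<theta> K) - (\<Sum>i\<in>K. T i j)"
      using j by (simp add: wedge_op_def distrib_left mult.assoc
          mult.left_commute[of "X j"] shuffle_sign_cancel)
  qed
  moreover have "(\<Sum>j\<in>- K. \<Sum>i\<in>K. T i j) = (\<Sum>i\<in>K. \<Sum>j\<in>- K. T i j)"
    by (rule sum.swap)
  ultimately show ?thesis
    by (simp add: sum.distrib sum_subtractf)
qed

text \<open>Interchanging the two contracted indices reverses the sign, so the double sum equals its
  own negative.\<close>

lemma contraction_contraction: "contraction X (contraction X \<theta>) = 0"
proof
  fix K
  let ?s = "\<lambda>i. shuffle_sign {i}"
  \<comment> \<open>The value 0 on the diagonal lets both indices range over all of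
    \<open>- K\<close>, although the inner contraction omits \<open>i\<close>.\<close>
  define T where "T i j = (if i = j then 0 else
    ?s i K * ?s j (insert i K) * (X i * (X j * \<theta> (insert j (insert i K)))))" for i j
  have "T i j = - T j i" if "i \<in> - K" "j \<in> - K" for i j
  proof (cases "i = j")
    case False
    then have "?s i K * ?s j (insert i K) = - (?s j K * ?s i (insert j K))"
      using that shuffle_sign_exchange[of i K j] by (simp add: mult.commute)
    then show ?thesis
      using False by (simp add: T_def insert_commute mult.left_commute[of "X i"])
  qed (simp add: T_def)
  then have "(\<Sum>i\<in>- K. \<Sum>j\<in>- K. T i j) = (\<Sum>i\<in>- K. \<Sum>j\<in>- K. - T j i)"
    by (intro sum.cong refl) blast
  also have "\<dots> = - (\<Sum>i\<in>- K. \<Sum>j\<in>- K. T i j)"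
    by (subst sum.swap) (simp add: sum_negf)
  finally have "2 * (\<Sum>i\<in>- K. \<Sum>j\<in>- K. T i j) = 0"
    unfolding mult_2 eq_neg_iff_add_eq_0 .
  then have "(\<Sum>i\<in>- K. \<Sum>j\<in>- K. T i j) = 0"
    by simp
  moreover have "contraction X (contraction X \<theta>) K = (\<Sum>i\<in>- K. \<Sum>j\<in>- K. T i j)"
    unfolding contraction_def sum_distrib_left
  proof (rule sum.cong[OF refl])
    fix i assume "i \<in> - K"
    show "(\<Sum>j\<in>- insert i K. ?s i K * X i * (?s j (insert i K) * X j * \<theta> (insert j (insert i K)))) =
        (\<Sum>j\<in>- K. T i j)"
      by (intro sum.mono_neutral_cong_left) (auto simp: T_def ac_simps)
  qed
  ultimately show "contraction X (contraction X \<theta>) K = 0 K"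
    by simp
qed

lemma contraction_add: "contraction X (\<theta> + \<theta>') = contraction X \<theta> + contraction X \<theta>'"
  by (simp add: contraction_def fun_eq_iff distrib_left sum.distrib)

lemma contraction_scale: "contraction X (form_scale P \<theta>) = form_scale P (contraction X \<theta>)"
  by (simp add: contraction_def form_scale_def fun_eq_iff sum_distrib_left ac_simps)

lemma contraction_zero: "contraction X 0 = 0"
  by (simp add: contraction_def fun_eq_iff)

section \<open>Degrees of forms and homogeneous components\<close>

lemma contraction_forms:
  assumes "\<theta> \<in> forms (Suc k)"
  shows "contraction X \<theta> \<in> forms k"
proof -
  have "\<theta> (insert i K) = 0" if "card K \<noteq> k" "i \<notin> K" for i and K :: "'a set"
    using assms that by (auto simp: forms_def)
  then show ?thesis
    by (auto simp: forms_def contraction_def intro!: sum.neutral)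
qed

lemma wedge_op_add:
  assumes "\<And>i. Modules.additive (D i)"
  shows "wedge_op D (\<theta> + \<theta>') = wedge_op D \<theta> + wedge_op D \<theta>'"
  by (simp add: wedge_op_def fun_eq_iff additive.add[OF assms] distrib_left sum.distrib)

text \<open>Projection to the k-forms. It allows exactness to be treated in all degrees at once and
  a single degree to be recovered afterwards.\<close>

definition degree_part :: "nat \<Rightarrow> 'n form \<Rightarrow> 'n form" where
  "degree_part k \<theta> = (\<lambda>K. if card K = k then \<theta> K else 0)"

lemma degree_part_forms: "degree_part k \<theta> \<in> forms k"
  by (simp add: degree_part_def forms_def)

lemma degree_part_idem: "\<theta> \<in> forms k \<Longrightarrow> degree_part k \<theta> = \<theta>"
  by (auto simp: degree_part_def forms_def fun_eq_iff)

lemma degree_part_add: "degree_part k (\<theta> + \<theta>') = degree_part k \<theta> + degree_part k \<theta>'"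
  by (auto simp: degree_part_def fun_eq_iff)

lemma degree_part_scale: "degree_part k (form_scale P \<theta>) = form_scale P (degree_part k \<theta>)"
  by (auto simp: degree_part_def form_scale_def fun_eq_iff)

lemma degree_part_zero: "degree_part k 0 = 0"
  by (auto simp: degree_part_def fun_eq_iff)

lemma wedge_op_degree_part:
  assumes "\<And>i. Modules.additive (D i)"
  shows "wedge_op D (degree_part k \<theta>) = degree_part (Suc k) (wedge_op D \<theta>)"
proof
  fix K :: "'a set"
  have "card (K - {i}) = k \<longleftrightarrow> card K = Suc k" if "i \<in> K" for i
    using that card_Suc_Diff1[of K i] by auto
  then show "wedge_op D (degree_part k \<theta>) K = degree_part (Suc k) (wedge_op D \<theta>) K"
    by (auto simp: wedge_op_def degree_part_def additive.zero[OF assms] intro!: sum.cong sum.neutral)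
qed

lemma wedge_op_forms:
  assumes "\<And>i. Modules.additive (D i)" and "\<theta> \<in> forms k"
  shows "wedge_op D \<theta> \<in> forms (Suc k)"
  by (metis degree_part_forms degree_part_idem wedge_op_degree_part assms)

lemma ext_deriv_add: "ext_deriv (\<theta> + \<theta>') = ext_deriv \<theta> + ext_deriv \<theta>'"
  unfolding ext_deriv_wedge_op by (rule wedge_op_add[OF additive_pdiff])

lemma ext_deriv_forms: "\<theta> \<in> forms k \<Longrightarrow> ext_deriv \<theta> \<in> forms (Suc k)"
  unfolding ext_deriv_wedge_op by (rule wedge_op_forms[OF additive_pdiff])

lemma forms_eq_zero:
  assumes "\<theta> \<in> forms k" "k > CARD('n)"
  shows "\<theta> = (0 :: 'n::finite form)"
  using assms card_mono[of "UNIV :: 'n set"] by (auto simp: forms_def fun_eq_iff) (metis finite leD subset_UNIV)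

lemma wedge_forms:
  assumes "\<alpha> \<in> forms a" "\<beta> \<in> forms b"
  shows "wedge \<alpha> \<beta> \<in> forms (a + b)"
proof -
  have "\<alpha> A = 0 \<or> \<beta> (K - A) = 0" if "A \<subseteq> K" "card K \<noteq> a + b" for A K :: "'a set"
  proof -
    have "card A \<noteq> a \<or> card (K - A) \<noteq> b"
      using that card_Diff_subset[of A K] card_mono[of K A] by auto
    then show ?thesis using assms by (auto simp: forms_def)
  qed
  then show ?thesis
    by (fastforce simp: forms_def wedge_def intro!: sum.neutral)
qed

section \<open>The Euler homotopy\<close>

text \<open>Inverse, on forms of positive degree, of the Lie derivative along the Euler field; the
  shift \<open>\<Sum>i\<in>K. p i\<close> is the weight of dx_K.\<close>

definition euler_homotopy :: "('n::finite \<Rightarrow> nat) \<Rightarrow> 'n form \<Rightarrow> 'n form" where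
  "euler_homotopy p \<theta> = (\<lambda>K. degree_quotient p (\<Sum>i\<in>K. p i) (\<theta> K))"

lemma additive_degree_quotient: "Modules.additive (degree_quotient p r)"
  by standard (rule degree_quotient_add)

lemma euler_homotopy_forms: "\<theta> \<in> forms k \<Longrightarrow> euler_homotopy p \<theta> \<in> forms k"
  by (auto simp: euler_homotopy_def forms_def additive.zero[OF additive_degree_quotient])

text \<open>Contraction trades dx_i for x_i, of the same weight \<open>p i\<close>, so both sides
  divide by the same weighted degrees.\<close>

lemma contraction_euler_homotopy:
  "contraction (euler_field p) (euler_homotopy p \<theta>) =
     euler_homotopy p (contraction (euler_field p) \<theta>)"
proof
  fix K
  have "degree_quotient p (\<Sum>i\<in>K. p i) (shuffle_sign {i} K * euler_field p i * \<theta> (insert i K)) =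
      shuffle_sign {i} K * euler_field p i * euler_homotopy p \<theta> (insert i K)" if "i \<in> - K" for i
  proof -
    have "(\<Sum>j\<in>insert i K. p j) = (\<Sum>j\<in>K. p j) + p i"
      using that by simp
    then show ?thesis
      by (simp add: euler_homotopy_def mult.assoc additive_shuffle_sign[OF additive_degree_quotient]
          degree_quotient_euler_field)
  qed
  then show "contraction (euler_field p) (euler_homotopy p \<theta>) K =
      euler_homotopy p (contraction (euler_field p) \<theta>) K"
    by (simp add: contraction_def euler_homotopy_def additive.sum[OF additive_degree_quotient])
qed

text \<open>Cartan's formula: the Lie derivative along the Euler field multiplies by the weighted degree.\<close>

lemma euler_homotopy_formula:
  fixes p :: "'n::{finite,linorder} \<Rightarrow> nat"
  assumes pos: "\<And>i. p i > 0" and "k > 0" and \<theta>: "\<theta> \<in> forms k"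
  shows "ext_deriv (contraction (euler_field p) (euler_homotopy p \<theta>)) +
    contraction (euler_field p) (ext_deriv (euler_homotopy p \<theta>)) = \<theta>"
proof
  fix K
  let ?X = "euler_field p" and ?r = "\<Sum>i\<in>K. p i"
  define R where "R = euler_homotopy p \<theta> K"
  have "ext_deriv (contraction ?X (euler_homotopy p \<theta>)) K +
      contraction ?X (ext_deriv (euler_homotopy p \<theta>)) K =
      (\<Sum>i\<in>K. pdiff i (?X i * R)) + (\<Sum>i\<in>- K. ?X i * pdiff i R)"
    unfolding ext_deriv_wedge_op R_def
    by (rule wedge_op_contraction[OF additive_pdiff]) (simp add: pdiff_mult pdiff_euler_field)
  \<comment> \<open>The product rule on the coefficient \<open>p i\<close> x_i produces the weight
    of dx_K.\<close>
  also have "(\<Sum>i\<in>K. pdiff i (?X i * R)) = of_nat ?r * R + (\<Sum>i\<in>K. ?X i * pdiff i R)"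
    by (simp add: pdiff_mult pdiff_euler_field sum.distrib sum_distrib_right)
  finally have "(ext_deriv (contraction ?X (euler_homotopy p \<theta>)) +
      contraction ?X (ext_deriv (euler_homotopy p \<theta>))) K = euler_deriv p R + of_nat ?r * R"
    using sum.union_disjoint[of K "- K" "\<lambda>i. ?X i * pdiff i R"]
    by (simp add: euler_deriv_def Compl_partition algebra_simps)
  also have "\<dots> = \<theta> K"
  proof (cases "card K = k")
    case True
    \<comment> \<open>Here \<open>K\<close> is nonempty because \<open>k > 0\<close>.\<close>
    then have "?r > 0"
      using \<open>k > 0\<close> pos by (intro sum_pos) (auto simp: card_gt_0_iff)
    then show ?thesis
      by (simp add: R_def euler_homotopy_def euler_deriv_degree_quotient del: of_nat_sum)
  next
    case False
    then have "\<theta> K = 0" "R = 0"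
      using \<theta> euler_homotopy_forms[OF \<theta>, of p] by (auto simp: forms_def R_def)
    then show ?thesis
      by (simp add: euler_deriv_def additive.zero[OF additive_pdiff])
  qed
  finally show "(ext_deriv (contraction ?X (euler_homotopy p \<theta>)) +
      contraction ?X (ext_deriv (euler_homotopy p \<theta>))) K = \<theta> K" .
qed

section \<open>Minors and exterior products\<close>

text \<open>For lists of equal length, the determinant expanded along its first column. The
  recursion deletes one covector at a time, just as contraction with a coordinate field does to an
  exterior product.\<close>

fun laplace :: "('v \<Rightarrow> 'a::comm_ring_1) list \<Rightarrow> 'v list \<Rightarrow> 'a" where
  "laplace as [] = 1"
| "laplace as (v # vs) =
     (\<Sum>j<length as. (-1) ^ j * (as ! j) v * laplace (take j as @ drop (Suc j) as) vs)"

text \<open>Dropping the covector \<open>j\<close> and the first column index is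
  \<open>mat_delete\<close> at row \<open>j\<close> and column 0, so the recursion is the column
  expansion.\<close>

lemma laplace_det:
  assumes "length as = length vs"
  shows "laplace as vs = det (mat (length vs) (length vs) (\<lambda>(i, j). (as ! i) (vs ! j)))"
  using assms
proof (induction vs arbitrary: as)
  case Nil
  then show ?case by (simp add: det_dim_zero)
next
  case (Cons v vs)
  define n where "n = length vs"
  define A where "A = mat (Suc n) (Suc n) (\<lambda>(i, j). (as ! i) ((v # vs) ! j))"
  have "laplace (take j as @ drop (Suc j) as) vs = det (mat_delete A j 0)" if "j < Suc n" for j
  proof -
    have len: "length (take j as @ drop (Suc j) as) = length vs"
      using that Cons.prems by (simp add: n_def)
    have "mat n n (\<lambda>(i, k). ((take j as @ drop (Suc j) as) ! i) (vs ! k)) = mat_delete A j 0"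
      using that Cons.prems
      by (intro eq_matI) (auto simp: mat_delete_def A_def nth_append n_def min_def)
    then show ?thesis
      using Cons.IH[OF len] by (simp add: n_def)
  qed
  then have "laplace as (v # vs) = (\<Sum>j<Suc n. A $$ (j, 0) * cofactor A j 0)"
    using Cons.prems by (auto simp: cofactor_def A_def n_def ac_simps intro!: sum.cong)
  also have "\<dots> = det A"
    by (rule laplace_expansion_column[symmetric]) (auto simp: A_def)
  finally show ?case
    by (simp add: A_def n_def)
qed

text \<open>\<open>covector_wedge a \<theta>\<close> is \<open>(\<Sum>\<^sub>i a\<^sub>i dx\<^sub>i) \<and> \<theta>\<close>.\<close>

definition covector_wedge :: "('n::{finite,linorder} \<Rightarrow> 'n mpoly) \<Rightarrow> 'n form \<Rightarrow> 'n form" where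
  "covector_wedge a = wedge_op (\<lambda>i. (*) (a i))"

lemma additive_mult: "Modules.additive ((*) (P :: 'n mpoly))"
  by standard (rule distrib_left)

lemma covector_wedge_add: "covector_wedge a (\<theta> + \<theta>') = covector_wedge a \<theta> + covector_wedge a \<theta>'"
  unfolding covector_wedge_def by (rule wedge_op_add[OF additive_mult])

lemma covector_wedge_scale: "covector_wedge a (form_scale P \<theta>) = form_scale P (covector_wedge a \<theta>)"
  by (simp add: covector_wedge_def wedge_op_def form_scale_def fun_eq_iff sum_distrib_left ac_simps)

lemma covector_wedge_forms: "\<theta> \<in> forms k \<Longrightarrow> covector_wedge a \<theta> \<in> forms (Suc k)"
  unfolding covector_wedge_def by (rule wedge_op_forms[OF additive_mult])

text \<open>The case of \<open>wedge_op_contraction\<close> where \<open>D i\<close> is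
  multiplication by \<open>a i\<close>: the diagonal sums over \<open>K\<close> and
  \<open>- K\<close> merge into the pairing of covector and field.\<close>

lemma contraction_covector_wedge:
  "contraction X (covector_wedge a \<theta>) =
     form_scale (\<Sum>i\<in>UNIV. a i * X i) \<theta> - covector_wedge a (contraction X \<theta>)"
proof -
  have "covector_wedge a (contraction X \<theta>) K + contraction X (covector_wedge a \<theta>) K =
      form_scale (\<Sum>i\<in>UNIV. a i * X i) \<theta> K" for K
  proof -
    have "covector_wedge a (contraction X \<theta>) K + contraction X (covector_wedge a \<theta>) K =
        (\<Sum>i\<in>K. a i * (X i * \<theta> K)) + (\<Sum>i\<in>- K. X i * (a i * \<theta> K))"
      unfolding covector_wedge_def
      by (rule wedge_op_contraction[OF additive_mult]) (rule mult.left_commute)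
    also have "\<dots> = (\<Sum>i\<in>K \<union> - K. a i * X i * \<theta> K)"
      by (subst sum.union_disjoint) (auto simp: ac_simps)
    finally show ?thesis
      by (simp add: form_scale_def sum_distrib_right Compl_partition)
  qed
  then show ?thesis
    by (simp add: fun_eq_iff eq_diff_eq add.commute)
qed

lemma ext_deriv_scale:
  "ext_deriv (form_scale P \<theta>) =
     covector_wedge (\<lambda>i. pdiff i P) \<theta> + form_scale P (ext_deriv \<theta>)"
  by (simp add: ext_deriv_def covector_wedge_def wedge_op_def form_scale_def fun_eq_iff pdiff_mult
      distrib_left sum.distrib sum_distrib_left ac_simps)

lemma additive_covector_wedge: "Modules.additive (covector_wedge a)"
  by standard (rule covector_wedge_add)

text \<open>Passing \<open>j\<close> covectors costs the sign \<open>(-1) ^ j\<close>; the last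
  summand is the one where the contraction reaches \<open>\<theta>\<close>.\<close>

lemma contraction_iterated_wedge:
  "contraction X (foldr covector_wedge as \<theta>) =
     (\<Sum>j<length as. form_scale ((-1) ^ j * (\<Sum>i\<in>UNIV. (as ! j) i * X i))
        (foldr covector_wedge (take j as @ drop (Suc j) as) \<theta>)) +
     form_scale ((-1) ^ length as) (foldr covector_wedge as (contraction X \<theta>))"
proof (induction as)
  case Nil
  show ?case by simp
next
  case (Cons a as)
  show ?case
    by (simp only: list.simps foldr.simps comp_apply contraction_covector_wedge Cons.IH list.size
        sum.lessThan_Suc_shift covector_wedge_add covector_wedge_scale
        additive.sum[OF additive_covector_wedge] diff_add_eq_diff_diff_swap nth_Cons_0 nth_Cons_Suc
        take_Suc_Cons drop_Suc_Cons append_Cons power_Suc power_0 take_0 append_Nil drop_0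
        mult_1_left add_Suc_right add_0_right)
      (simp add: algebra_simps sum_negf)
qed

section \<open>Iterated contraction with coordinate fields\<close>

definition unit_contraction :: "'n::{finite,linorder} \<Rightarrow> 'n form \<Rightarrow> 'n form" where
  "unit_contraction v = contraction (\<lambda>i. if i = v then 1 else 0)"

lemma unit_contraction_iterated_wedge:
  "unit_contraction v (foldr covector_wedge as \<theta>) =
     (\<Sum>j<length as. form_scale ((-1) ^ j * (as ! j) v)
        (foldr covector_wedge (take j as @ drop (Suc j) as) \<theta>)) +
     form_scale ((-1) ^ length as) (foldr covector_wedge as (unit_contraction v \<theta>))"
  by (simp add: unit_contraction_def contraction_iterated_wedge if_distrib cong: if_cong)

lemma iterated_contraction_add:
  "fold unit_contraction vs (\<theta> + \<theta>') =
     fold unit_contraction vs \<theta> + fold unit_contraction vs \<theta>'"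
  by (induction vs arbitrary: \<theta> \<theta>') (simp_all add: unit_contraction_def contraction_add)

lemma iterated_contraction_scale:
  "fold unit_contraction vs (form_scale P \<theta>) = form_scale P (fold unit_contraction vs \<theta>)"
  by (induction vs arbitrary: \<theta>) (simp_all add: unit_contraction_def contraction_scale)

lemma iterated_contraction_sum:
  "fold unit_contraction vs (\<Sum>j\<in>A. \<theta> j) = (\<Sum>j\<in>A. fold unit_contraction vs (\<theta> j))"
proof -
  have "Modules.additive (fold unit_contraction vs :: 'a form \<Rightarrow> 'a form)"
    by standard (rule iterated_contraction_add)
  from additive.sum[OF this] show ?thesis .
qed

text \<open>The ideal of the exterior algebra generated by the covectors; it collects the remainders
  of the contraction argument.\<close>

definition wedge_span :: "('n::{finite,linorder} \<Rightarrow> 'n mpoly) list \<Rightarrow> 'n form set" where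
  "wedge_span as = form_module.span (\<Union>a\<in>set as. range (covector_wedge a))"

lemma wedge_span_mono: "set bs \<subseteq> set as \<Longrightarrow> wedge_span bs \<subseteq> wedge_span as"
  unfolding wedge_span_def by (intro form_module.span_mono) auto

lemma wedge_span_remove: "wedge_span (take j as @ drop (Suc j) as) \<subseteq> wedge_span as"
  by (rule wedge_span_mono) (auto dest: in_set_takeD in_set_dropD)

text \<open>Each contraction removes at most one covector, so with fewer contractions than covectors
  some covector survives in every term.\<close>

lemma iterated_contraction_in_wedge_span:
  assumes "length vs < length as"
  shows "fold unit_contraction vs (foldr covector_wedge as \<theta>) \<in> wedge_span as"
  using assms
proof (induction vs arbitrary: as \<theta>)
  case Nil
  then obtain a bs where "as = a # bs" by (cases as) auto
  then show ?case
    by (auto simp: wedge_span_def intro!: form_module.span_base)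
next
  case (Cons v vs)
  have "fold unit_contraction vs (foldr covector_wedge (take j as @ drop (Suc j) as) \<theta>) \<in> wedge_span as"
    if "j < length as" for j
    using that Cons.prems
    by (intro subsetD[OF wedge_span_remove Cons.IH]) auto
  moreover have "fold unit_contraction vs (foldr covector_wedge as (unit_contraction v \<theta>)) \<in> wedge_span as"
    using Cons.prems by (intro Cons.IH) auto
  ultimately show ?case
    unfolding wedge_span_def fold_simps unit_contraction_iterated_wedge iterated_contraction_add
      iterated_contraction_sum iterated_contraction_scale
    by (intro form_module.span_add form_module.span_sum form_module.span_scale) auto
qed

text \<open>The first contraction either removes covector \<open>j\<close>, giving the j-th term of
  the expansion by induction, or hits \<open>\<theta>\<close>. In the latter case more covectors
  than contractions are left, so the term is a remainder.\<close>

lemma iterated_contraction_laplace: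
  assumes "length vs = length as"
  shows "fold unit_contraction vs (foldr covector_wedge as \<theta>) - form_scale (laplace as vs) \<theta>
    \<in> wedge_span as"
  using assms
proof (induction vs arbitrary: as \<theta>)
  case Nil
  then have "as = []" by simp
  show ?case
    unfolding \<open>as = []\<close> wedge_span_def fold_simps laplace.simps foldr.simps id_apply form_module.scale_one
      diff_self
    by (rule form_module.span_zero)
next
  case (Cons v vs)
  let ?del = "\<lambda>j. take j as @ drop (Suc j) as"
  let ?I = "fold unit_contraction vs"
  have *: "?I (foldr covector_wedge (?del j) \<theta>) - form_scale (laplace (?del j) vs) \<theta> \<in> wedge_span as"
    if "j < length as" for j
    using that Cons.prems by (intro subsetD[OF wedge_span_remove Cons.IH]) auto
  have **: "?I (foldr covector_wedge as (unit_contraction v \<theta>)) \<in> wedge_span as"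
    using Cons.prems by (intro iterated_contraction_in_wedge_span) auto
  have "fold unit_contraction (v # vs) (foldr covector_wedge as \<theta>) -
      form_scale (laplace as (v # vs)) \<theta> =
      (\<Sum>j<length as. form_scale ((-1) ^ j * (as ! j) v)
        (?I (foldr covector_wedge (?del j) \<theta>) - form_scale (laplace (?del j) vs) \<theta>)) +
      form_scale ((-1) ^ length as) (?I (foldr covector_wedge as (unit_contraction v \<theta>)))"
    by (simp add: unit_contraction_iterated_wedge iterated_contraction_add
        iterated_contraction_sum iterated_contraction_scale form_module.scale_sum_left
        form_module.scale_right_diff_distrib sum_subtractf)
  also have "\<dots> \<in> wedge_span as"
    using * ** unfolding wedge_span_def
    by (intro form_module.span_add form_module.span_sum form_module.span_scale) auto
  finally show ?case .
qed

text \<open>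
  Contracting the vanishing form \<open>a\<^sub>1 \<and> \<dots> \<and> a\<^sub>q \<and> \<theta>\<close> of degree above \<open>n\<close> with \<open>q\<close> coordinate
  fields leaves the minor times \<open>\<theta>\<close>, up to multiples of the \<open>a\<^sub>i\<close>.
\<close>

lemma minor_in_wedge_span:
  fixes \<theta> :: "'n::{finite,linorder} form"
  assumes "length vs = length as" and "\<theta> \<in> forms k" and "k + length as > CARD('n)"
  shows "form_scale (laplace as vs) \<theta> \<in> wedge_span as"
proof -
  have "foldr covector_wedge as \<theta> \<in> forms (k + length as)"
    by (induction as) (simp_all add: assms covector_wedge_forms)
  then have "foldr covector_wedge as \<theta> = 0"
    using assms(3) by (rule forms_eq_zero)
  moreover have "fold unit_contraction vs 0 = (0 :: 'n form)"
    using iterated_contraction_scale[of vs 0 0] by simp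
  ultimately have "- form_scale (laplace as vs) \<theta> \<in> wedge_span as"
    using iterated_contraction_laplace[OF assms(1), of \<theta>] by simp
  then show ?thesis
    unfolding wedge_span_def using form_module.span_neg by fastforce
qed

section \<open>Exactness at infinity\<close>

text \<open>Exactness at infinity without fixing a degree, which spares degree bookkeeping;
  \<open>exact_at_infinity_eq\<close> restores the degree.\<close>

definition exact_modulo :: "'n::{finite,linorder} mpoly set \<Rightarrow> 'n form set" where
  "exact_modulo I =
     {ext_deriv \<alpha> + \<beta> | \<alpha> \<beta>. \<beta> \<in> form_module.span {form_scale P \<theta> | P \<theta>. P \<in> I}}"

lemma exact_modulo_add:
  assumes "\<theta> \<in> exact_modulo I" "\<theta>' \<in> exact_modulo I"
  shows "\<theta> + \<theta>' \<in> exact_modulo I"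
proof -
  let ?S = "form_module.span {form_scale P \<theta> | P \<theta>. P \<in> I}"
  obtain \<alpha> \<beta> \<alpha>' \<beta>' where "\<theta> = ext_deriv \<alpha> + \<beta>" "\<theta>' = ext_deriv \<alpha>' + \<beta>'" "\<beta> \<in> ?S" "\<beta>' \<in> ?S"
    using assms by (auto simp: exact_modulo_def)
  then have "\<theta> + \<theta>' = ext_deriv (\<alpha> + \<alpha>') + (\<beta> + \<beta>')" "\<beta> + \<beta>' \<in> ?S"
    by (simp_all only: ext_deriv_add form_module.span_add ac_simps)
  then show ?thesis unfolding exact_modulo_def by blast
qed

lemma ext_deriv_zero: "ext_deriv 0 = 0"
  using ext_deriv_add[of 0 0] by simp

lemma exact_moduloI:
  "\<beta> \<in> form_module.span {form_scale P \<theta> | P \<theta>. P \<in> I} \<Longrightarrow> ext_deriv \<alpha> + \<beta> \<in> exact_modulo I"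
  unfolding exact_modulo_def by blast

lemma ideal_multiple_exact_modulo:
  assumes "P \<in> I"
  shows "form_scale P \<theta> \<in> exact_modulo I"
proof -
  have "form_scale P \<theta> \<in> form_module.span {form_scale P \<theta> | P \<theta>. P \<in> I}"
    using assms by (blast intro: form_module.span_base)
  from exact_moduloI[OF this, of 0] show ?thesis
    by (simp only: ext_deriv_zero add_0_left)
qed

lemma ext_deriv_exact_modulo: "ext_deriv \<alpha> \<in> exact_modulo I"
  using exact_moduloI[OF form_module.span_zero, of \<alpha>] by (simp only: add_0_right)

lemma zero_exact_modulo: "0 \<in> exact_modulo I"
  using ext_deriv_exact_modulo[of 0] by (simp only: ext_deriv_zero)

lemma uminus_exact_modulo:
  assumes "\<theta> \<in> exact_modulo I"
  shows "- \<theta> \<in> exact_modulo I"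
proof -
  obtain \<alpha> \<beta> where \<theta>: "\<theta> = ext_deriv \<alpha> + \<beta>"
    and \<beta>: "\<beta> \<in> form_module.span {form_scale P \<theta> | P \<theta>. P \<in> I}"
    using assms by (auto simp: exact_modulo_def)
  have "ext_deriv (- \<alpha>) + ext_deriv \<alpha> = 0"
    by (simp only: ext_deriv_add[symmetric] left_minus ext_deriv_zero)
  then have "ext_deriv (- \<alpha>) = - ext_deriv \<alpha>"
    by (rule eq_neg_iff_add_eq_0[THEN iffD2])
  then have "- \<theta> = ext_deriv (- \<alpha>) + - \<beta>"
    by (simp only: \<theta> minus_add_distrib)
  then show ?thesis
    using exact_moduloI[OF form_module.span_neg[OF \<beta>]] by simp
qed

lemma degree_part_ideal_forms:
  assumes "\<beta> \<in> form_module.span {form_scale P \<theta> | P \<theta>. P \<in> I}"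
  shows "degree_part k \<beta> \<in> ideal_forms I k"
  using assms
proof (induction rule: form_module.span_induct_alt)
  case base
  show ?case by (simp only: degree_part_zero ideal_forms_def form_module.span_zero)
next
  case (step c x y)
  then obtain P \<theta> where x: "x = form_scale P \<theta>" "P \<in> I" by blast
  have "form_scale P (degree_part k \<theta>) \<in> ideal_forms I k"
    unfolding ideal_forms_def using x(2) degree_part_forms by (blast intro: form_module.span_base)
  with step(2) show ?case
    unfolding x degree_part_add degree_part_scale ideal_forms_def
    by (intro form_module.span_add[OF form_module.span_scale])
qed

lemma ideal_forms_subset_forms: "ideal_forms I k \<subseteq> forms k"
  unfolding ideal_forms_def
  by (rule form_module.span_minimal)
    (auto simp: form_module.subspace_def forms_def form_scale_def)

text \<open>The exterior derivative raises degrees by one, so a decomposition in mixed degrees can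
  be projected to degrees \<open>k\<close> and \<open>Suc k\<close>.\<close>

lemma exact_at_infinity_eq:
  "exact_at_infinity p q f (Suc k) = exact_modulo (ideal_at_infinity p q f) \<inter> forms (Suc k)"
proof (intro equalityI subsetI)
  let ?I = "ideal_at_infinity p q f"
  fix \<theta>
  {
    assume "\<theta> \<in> exact_at_infinity p q f (Suc k)"
    then obtain \<alpha> \<beta> where \<theta>: "\<theta> = ext_deriv \<alpha> + \<beta>" and \<alpha>: "\<alpha> \<in> forms k"
      and \<beta>: "\<beta> \<in> ideal_forms ?I (Suc k)"
      by (auto simp: exact_at_infinity_def elim!: set_plus_elim)
    have "\<beta> \<in> form_module.span {form_scale P \<theta> | P \<theta>. P \<in> ?I}"
      using \<beta> form_module.span_mono[of "{form_scale P \<theta> | P \<theta>. P \<in> ?I \<and> \<theta> \<in> forms (Suc k)}"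
        "{form_scale P \<theta> | P \<theta>. P \<in> ?I}"]
      unfolding ideal_forms_def by blast
    moreover have "\<theta> \<in> forms (Suc k)"
      using ext_deriv_forms[OF \<alpha>] \<beta> ideal_forms_subset_forms unfolding \<theta>
      by (fastforce simp: forms_def)
    ultimately show "\<theta> \<in> exact_modulo ?I \<inter> forms (Suc k)"
      unfolding \<theta> using exact_moduloI by blast
  next
    assume "\<theta> \<in> exact_modulo ?I \<inter> forms (Suc k)"
    then obtain \<alpha> \<beta> where \<theta>: "\<theta> = ext_deriv \<alpha> + \<beta>"
      and \<beta>: "\<beta> \<in> form_module.span {form_scale P \<theta> | P \<theta>. P \<in> ?I}"
      and "\<theta> = degree_part (Suc k) \<theta>"
      by (auto simp: exact_modulo_def degree_part_idem)
    then have "\<theta> = ext_deriv (degree_part k \<alpha>) + degree_part (Suc k) \<beta>"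
      by (simp only: degree_part_add ext_deriv_wedge_op wedge_op_degree_part[OF additive_pdiff])
    then show "\<theta> \<in> exact_at_infinity p q f (Suc k)"
      unfolding exact_at_infinity_def
      using degree_part_forms[of k \<alpha>] degree_part_ideal_forms[OF \<beta>, of "Suc k"]
      by (auto intro!: set_plus_intro simp del: plus_fun_apply)
  }
qed

text \<open>The product in the closedness condition has degree \<open>k + 1 + q\<close>, one more
  than the dimension, and so vanishes.\<close>

lemma closed_at_infinity_top:
  fixes p :: "'n::{finite,linorder} \<Rightarrow> nat"
  assumes "k + q = CARD('n)"
  shows "closed_at_infinity p q f k = forms k"
proof -
  have "foldl wedge (ext_deriv \<theta>) (map (\<lambda>i. ext_deriv (function_form (leading_term p (f i)))) [0..<m])
      \<in> forms (k + 1 + m)" if "\<theta> \<in> forms k" for \<theta> :: "'n form" and m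
  proof (induction m)
    case 0
    show ?case using ext_deriv_forms[OF that] by simp
  next
    case (Suc m)
    have "function_form (leading_term p (f m)) \<in> forms 0"
      by (auto simp: function_form_def forms_def)
    from wedge_forms[OF Suc ext_deriv_forms[OF this]] show ?case
      by simp
  qed
  from forms_eq_zero[OF this, of _ q] assms
  show ?thesis
    by (auto simp: closed_at_infinity_def ideal_forms_def form_module.span_zero)
qed

section \<open>Multipliers of the kernel of contraction into the exact forms\<close>

text \<open>Contracting dg wedge eta leaves X(g) eta, an ideal multiple by Euler's identity, and a
  multiple of dg, which is exact up to a multiple of g by the Leibniz rule.\<close>

lemma wedge_span_contraction_exact:
  assumes "\<theta> \<in> wedge_span (map (\<lambda>i j. pdiff j (leading_term p (f i))) [0..<q])"
  shows "contraction (euler_field p) \<theta> \<in> exact_modulo (ideal_at_infinity p q f)"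
  using assms unfolding wedge_span_def
proof (induction rule: form_module.span_induct_alt)
  case base
  show ?case by (simp only: contraction_zero zero_exact_modulo)
next
  case (step c x y)
  let ?I = "ideal_at_infinity p q f" and ?X = "euler_field p"
  from step(1) obtain i \<eta> where i: "i < q"
    and x: "x = covector_wedge (\<lambda>j. pdiff j (leading_term p (f i))) \<eta>"
    by auto
  define g where "g = leading_term p (f i)"
  have "g \<in> ?I"
    unfolding ideal_at_infinity_def g_def
    by (rule module.span_base[OF module_mpoly]) (use i in blast)
  then have multiple: "P * g \<in> ?I" for P
    unfolding ideal_at_infinity_def by (rule module.span_scale[OF module_mpoly])
  obtain d where d: "euler_deriv p g = of_nat d * g"
    unfolding g_def using euler_deriv_leading_term by blast
  \<comment> \<open>The scalar \<open>c\<close> is absorbed into the form first, since exact forms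
    are not stable under multiplication by polynomials.\<close>
  define \<eta>' where "\<eta>' = contraction ?X (form_scale c \<eta>)"
  have "contraction ?X (form_scale c x) =
      form_scale (euler_deriv p g) (form_scale c \<eta>) - covector_wedge (\<lambda>j. pdiff j g) \<eta>'"
    unfolding x g_def[symmetric] covector_wedge_scale[symmetric] contraction_covector_wedge \<eta>'_def
    by (simp only: euler_deriv_def mult.commute)
  also have "\<dots> = form_scale (of_nat d * g) (form_scale c \<eta>) +
      (ext_deriv (form_scale g (- \<eta>')) + form_scale g (ext_deriv \<eta>'))"
  proof -
    have "ext_deriv (form_scale g (- \<eta>')) + ext_deriv (form_scale g \<eta>') = 0"
      by (simp only: ext_deriv_add[symmetric] form_module.scale_right_distrib[symmetric]
          add.left_inverse form_module.scale_zero_right ext_deriv_zero)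
    then have "ext_deriv (form_scale g (- \<eta>')) =
        - (covector_wedge (\<lambda>j. pdiff j g) \<eta>' + form_scale g (ext_deriv \<eta>'))"
      unfolding ext_deriv_scale[of g \<eta>'] by (rule eq_neg_iff_add_eq_0[THEN iffD2])
    then show ?thesis
      unfolding d by (simp only: minus_add_distrib add.assoc left_minus right_minus
          add_0_right diff_conv_add_uminus)
  qed
  also have "\<dots> \<in> exact_modulo ?I"
    using multiple[of "of_nat d"] \<open>g \<in> ?I\<close>
    by (intro exact_modulo_add ideal_multiple_exact_modulo ext_deriv_exact_modulo)
  finally show ?case
    unfolding contraction_add using step(2) by (rule exact_modulo_add)
qed

lemma jacobian_minor_exact:
  fixes p :: "'n::{finite,linorder} \<Rightarrow> nat"
  assumes pos: "\<And>i. p i > 0" and k: "k > 0" "k + q = CARD('n)"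
    and M: "card M = q"
    and \<theta>: "\<theta> \<in> forms k" "contraction (euler_field p) \<theta> = 0"
  shows "form_scale (jacobian_minor p q f M) \<theta> \<in> exact_modulo (ideal_at_infinity p q f)"
proof -
  let ?X = "euler_field p"
  let ?as = "map (\<lambda>i j. pdiff j (leading_term p (f i))) [0..<q]" and ?vs = "sorted_list_of_set M"
  define \<eta> where "\<eta> = ext_deriv (euler_homotopy p \<theta>)"
  have "euler_homotopy p 0 = 0"
    by (simp add: euler_homotopy_def fun_eq_iff additive.zero[OF additive_degree_quotient])
  \<comment> \<open>Contraction commutes with the homotopy and kills \<open>\<theta>\<close>, so the
    first term of Cartan's formula drops out.\<close>
  then have "\<theta> = contraction ?X \<eta>"
    using euler_homotopy_formula[where p = p, OF pos k(1) \<theta>(1)]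
    unfolding contraction_euler_homotopy \<theta>(2) \<eta>_def by (simp only: ext_deriv_zero add_0_left)
  moreover have "jacobian_minor p q f M = laplace ?as ?vs"
  proof -
    have "mat q q (\<lambda>(i, j). (?as ! i) (?vs ! j)) =
        mat q q (\<lambda>(i, j). pdiff (?vs ! j) (leading_term p (f i)))"
      by (rule eq_matI) auto
    then show ?thesis
      using M by (simp add: laplace_det jacobian_minor_def)
  qed
  \<comment> \<open>Passing from \<open>\<theta>\<close> to \<open>\<eta>\<close> gains the one
    degree that pushes the product with all q differentials above the dimension.\<close>
  moreover have "form_scale (laplace ?as ?vs) \<eta> \<in> wedge_span ?as"
  proof (rule minor_in_wedge_span)
    show "\<eta> \<in> forms (Suc k)"
      unfolding \<eta>_def by (intro ext_deriv_forms euler_homotopy_forms \<theta>(1))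
  qed (use M k in auto)
  ultimately show ?thesis
    using wedge_span_contraction_exact by (simp only: contraction_scale[symmetric])
qed

text \<open>A polynomial coefficient of a minor is moved onto \<open>\<theta>\<close>, which stays
  in the kernel because contraction is linear over polynomials.\<close>

lemma jacobian_ideal_exact:
  fixes p :: "'n::{finite,linorder} \<Rightarrow> nat"
  assumes pos: "\<And>i. p i > 0" and k: "k > 0" "k + q = CARD('n)"
    and \<theta>: "\<theta> \<in> forms k" "contraction (euler_field p) \<theta> = 0"
    and "P \<in> jacobian_ideal p q f"
  shows "form_scale P \<theta> \<in> exact_modulo (ideal_at_infinity p q f)"
  using assms(6) unfolding jacobian_ideal_def
proof (induction rule: module.span_induct_alt[OF module_mpoly, consumes 1])
  case 1
  show ?case by (simp only: form_module.scale_zero_left zero_exact_modulo)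
next
  case (2 c x y)
  then obtain M where M: "x = jacobian_minor p q f M" "card M = q"
    by blast
  have "form_scale (c * x) \<theta> = form_scale x (form_scale c \<theta>)"
    by (simp add: form_scale_def ac_simps)
  also have "\<dots> \<in> exact_modulo (ideal_at_infinity p q f)"
    unfolding M(1)
  proof (rule jacobian_minor_exact[OF pos k M(2)])
    show "form_scale c \<theta> \<in> forms k"
      using \<theta>(1) by (simp add: forms_def form_scale_def)
    show "contraction (euler_field p) (form_scale c \<theta>) = 0"
      by (simp only: contraction_scale \<theta>(2) form_module.scale_zero_right)
  qed
  finally show ?case
    unfolding form_module.scale_left_distrib using 2(2) by (rule exact_modulo_add)
qed

section \<open>Cosets and the generating system of the quotient\<close>

lemma coset_eqI:
  fixes W :: "'b::ab_group_add set"
  assumes "\<And>x y. x \<in> W \<Longrightarrow> y \<in> W \<Longrightarrow> x + y \<in> W" "\<And>x. x \<in> W \<Longrightarrow> - x \<in> W" "v - u \<in> W"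
  shows "u +o W = v +o W"
proof -
  have "a +o W \<subseteq> b +o W" if "a - b \<in> W" for a b
    using assms(1)[OF that] by (force simp: elt_set_plus_def intro: bexI[where x = "a - b + _"])
  from this[of u v] this[of v u] show ?thesis
    using assms(2)[OF assms(3)] assms(3) by auto
qed

lemma coset_representative:
  assumes "a +o W = u +o W" "(0 :: 'b::ab_group_add) \<in> W"
  shows "a - u \<in> W"
proof -
  have "a + 0 \<in> u +o W"
    using assms by (metis set_plus_intro2)
  then show ?thesis
    by (auto simp: elt_set_plus_def)
qed

theorem proposition1p4:
  fixes p :: "'n::{finite,linorder} \<Rightarrow> nat"
    and q :: nat
    and f :: "nat \<Rightarrow> 'n mpoly"
    and P :: "'k \<Rightarrow> 'n mpoly" and K :: "'k set"
    and \<omega> :: "'l \<Rightarrow> 'n form" and L :: "'l set"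
  assumes "1 \<le> q" and "q < CARD('n)"
    and "\<And>i. p i > 0"
    and "algebraically_independent q f"
    and "isolated_complete_intersection_at_infinity p q f"
    and "basis_of_quotient poly_cscale UNIV (ideal_at_infinity p q f + jacobian_ideal p q f) P K"
    and "form_module.span (\<omega> ` L) =
           {\<eta> \<in> forms (CARD('n) - q). contraction (euler_field p) \<eta> = 0}"
  shows "generates_quotient form_cscale
           (closed_at_infinity p q f (CARD('n) - q))
           (exact_at_infinity p q f (CARD('n) - q))
           {form_scale (P k) (\<omega> l) | k l. k \<in> K \<and> l \<in> L}"
proof -
  let ?X = "euler_field p"
  define I J where "I = ideal_at_infinity p q f" and "J = jacobian_ideal p q f"
  define E where "E = exact_modulo I"
  define S where "S = {form_scale (P k) (\<omega> l) | k l. k \<in> K \<and> l \<in> L}"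
  define G where "G = form_vs.span S"
  \<comment> \<open>The degree is positive since \<open>q < CARD('n)\<close>, as both the homotopy
    and \<open>exact_at_infinity_eq\<close> require.\<close>
  obtain k' where k': "CARD('n) - q = Suc k'"
    using assms(2) by (metis Suc_diff_Suc)
  define k where "k = Suc k'"
  have k: "k > 0" "k + q = CARD('n)"
    using k' assms(2) by (simp_all add: k_def)
  have V: "closed_at_infinity p q f k = forms k"
    by (rule closed_at_infinity_top[OF k(2)])
  have W: "exact_at_infinity p q f k = E \<inter> forms k"
    unfolding k_def E_def I_def by (rule exact_at_infinity_eq)
  have ker: "form_module.span (\<omega> ` L) = {\<eta> \<in> forms k. contraction ?X \<eta> = 0}"
    using assms(7) k' by (simp add: k_def)
  have \<omega>: "\<omega> l \<in> forms k" "contraction ?X (\<omega> l) = 0" if "l \<in> L" for l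
    using ker form_module.span_base[of "\<omega> l" "\<omega> ` L"] that by blast+

  have "S \<subseteq> forms k"
    using \<omega>(1) by (auto simp: S_def forms_def form_scale_def)
  moreover have "form_vs.subspace (forms k)"
    by (auto simp: form_vs.subspace_def forms_def form_cscale_def form_scale_def)
  ultimately have G_forms: "G \<subseteq> forms k"
    unfolding G_def by (rule form_vs.span_minimal)

  have zero: "0 \<in> I + J"
    unfolding I_def J_def ideal_at_infinity_def jacobian_ideal_def
    using set_plus_intro[OF module.span_zero[OF module_mpoly] module.span_zero[OF module_mpoly]]
    by (simp only: add_0_left)
  \<comment> \<open>Reduce the coefficient \<open>a\<close> modulo \<open>I + J\<close> to a complex
    combination of the \<open>P k\<close>; the remainder multiplies \<open>\<omega> l\<close> into
    \<open>E\<close>, its part in \<open>J\<close> doing so because \<open>\<omega> l\<close> lies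
    in the kernel.\<close>
  have generator: "\<exists>u\<in>G. form_scale a (\<omega> l) - u \<in> E" if l: "l \<in> L" for a l
  proof -
    have "a +o (I + J) \<in> (\<lambda>u. u +o (I + J)) ` poly_vs.span (P ` K)"
      using assms(6) unfolding basis_of_quotient_def generates_quotient_def quotient_space_def
        I_def J_def by blast
    then obtain u where u: "u \<in> poly_vs.span (P ` K)" and "a +o (I + J) = u +o (I + J)"
      by blast
    then obtain i j where ij: "i \<in> I" "j \<in> J" "a - u = i + j"
      using coset_representative[OF _ zero] by (metis set_plus_elim)
    have "form_scale u (\<omega> l) \<in> G"
      using u
    proof (induction rule: poly_vs.span_induct_alt)
      case base
      show ?case unfolding G_def by (simp only: form_module.scale_zero_left form_vs.span_zero)
    next
      case (step c x y)
      then have "form_scale x (\<omega> l) \<in> G"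
        unfolding G_def S_def using l by (blast intro: form_vs.span_base)
      then have "form_cscale c (form_scale x (\<omega> l)) + form_scale y (\<omega> l) \<in> G"
        using step(2) unfolding G_def by (intro form_vs.span_add[OF form_vs.span_scale])
      moreover have "form_cscale c (form_scale x (\<omega> l)) + form_scale y (\<omega> l) =
          form_scale (poly_cscale c x + y) (\<omega> l)"
        by (simp only: form_cscale_def poly_cscale_def form_module.scale_scale
            form_module.scale_left_distrib)
      ultimately show ?case by simp
    qed
    moreover have "form_scale a (\<omega> l) - form_scale u (\<omega> l) = form_scale i (\<omega> l) + form_scale j (\<omega> l)"
      by (simp only: form_module.scale_left_diff_distrib[symmetric] ij(3)
          form_module.scale_left_distrib)
    moreover have "form_scale i (\<omega> l) + form_scale j (\<omega> l) \<in> E"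
      unfolding E_def
    proof (rule exact_modulo_add[OF ideal_multiple_exact_modulo[OF ij(1)]])
      show "form_scale j (\<omega> l) \<in> exact_modulo I"
        unfolding I_def using ij(2)
        by (intro jacobian_ideal_exact[OF assms(3) k \<omega>[OF l]]) (simp add: J_def)
    qed
    ultimately show ?thesis
      by (intro bexI[of _ "form_scale u (\<omega> l)"]) (simp_all only:)
  qed
  have kernel: "\<exists>u\<in>G. \<theta> - u \<in> E" if "\<theta> \<in> form_module.span (\<omega> ` L)" for \<theta>
    using that
  proof (induction rule: form_module.span_induct_alt)
    case base
    have "0 - 0 \<in> E" unfolding E_def diff_self by (rule zero_exact_modulo)
    then show ?case unfolding G_def using form_vs.span_zero by blast
  next
    case (step c x y)
    then obtain u u' where u: "u \<in> G" "form_scale c x - u \<in> E" "u' \<in> G" "y - u' \<in> E"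
      using generator by blast
    then have "u + u' \<in> G" "form_scale c x - u + (y - u') \<in> E"
      unfolding G_def E_def by (blast intro: form_vs.span_add exact_modulo_add)+
    then show ?case by (metis add_diff_add)
  qed
  \<comment> \<open>Cartan's formula splits off an exact form, and the rest is a contraction, hence
    in the kernel because contracting twice gives 0.\<close>
  have all: "\<exists>u\<in>G. \<theta> - u \<in> E" if \<theta>: "\<theta> \<in> forms k" for \<theta>
  proof -
    define \<eta> where "\<eta> = contraction ?X (ext_deriv (euler_homotopy p \<theta>))"
    define \<alpha> where "\<alpha> = contraction ?X (euler_homotopy p \<theta>)"
    have "\<eta> \<in> form_module.span (\<omega> ` L)"
      unfolding ker \<eta>_def
      by (simp add: contraction_contraction contraction_forms ext_deriv_forms euler_homotopy_forms \<theta>)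
    then obtain u where u: "u \<in> G" "\<eta> - u \<in> E"
      using kernel by blast
    have "\<theta> = ext_deriv \<alpha> + \<eta>"
      unfolding \<alpha>_def \<eta>_def by (rule euler_homotopy_formula[OF assms(3) k(1) \<theta>, symmetric])
    then have "\<theta> - u = ext_deriv \<alpha> + (\<eta> - u)"
      by (simp only: add_diff_eq)
    also have "\<dots> \<in> E"
      using u(2) unfolding E_def by (intro exact_modulo_add ext_deriv_exact_modulo)
    finally show ?thesis using u(1) by blast
  qed

  \<comment> \<open>Representatives \<open>u\<close> and \<open>v\<close> are both k-forms, so a
    difference in \<open>E\<close> lies in \<open>E \<inter> forms k\<close>.\<close>
  have "(\<lambda>u. u +o (E \<inter> forms k)) ` G = (\<lambda>v. v +o (E \<inter> forms k)) ` forms k"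
  proof (rule equalityI[OF image_mono[OF G_forms] subsetI])
    fix A assume "A \<in> (\<lambda>v. v +o (E \<inter> forms k)) ` forms k"
    then obtain v where v: "v \<in> forms k" and A: "A = v +o (E \<inter> forms k)"
      by blast
    obtain u where u: "u \<in> G" "v - u \<in> E"
      using all[OF v] by blast
    have "u +o (E \<inter> forms k) = v +o (E \<inter> forms k)"
    proof (rule coset_eqI)
      show "x + y \<in> E \<inter> forms k" if "x \<in> E \<inter> forms k" "y \<in> E \<inter> forms k" for x y
        using that exact_modulo_add[of x I y] by (auto simp: E_def forms_def)
      show "- x \<in> E \<inter> forms k" if "x \<in> E \<inter> forms k" for x
        using that uminus_exact_modulo[of x I] by (auto simp: E_def forms_def)
      show "v - u \<in> E \<inter> forms k"
        using u v G_forms by (auto simp: forms_def)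
    qed
    then show "A \<in> (\<lambda>u. u +o (E \<inter> forms k)) ` G"
      using u(1) A by blast
  qed
  then show ?thesis
    using \<open>S \<subseteq> forms k\<close> V W k'
    by (simp add: generates_quotient_def quotient_space_def G_def S_def k_def)
qed

end
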